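(* Let $\bar{a}(N)$ denote the number of partitions $\lambda$ of $N$ with at least two parts, no parts of size $1$, and $\lambda_1=\lambda_2$. For every $j\in\mathbb{N}$ and every integer $n\ge 2j+2$, $$PM(2n-j,n-j)-PM(2(n-1)-j,(n-1)-j)=\bar{a}(n+1).$$
   Context: A partition $\lambda=(\lambda_1\ge\cdots\ge\lambda_\ell)$ of $n$ is a finite nonincreasing sequence of positive integers with sum $n$; $\ell(\lambda)$ is its number of parts. The hook length $h_{(i,j)}(\lambda)$ of a cell $(i,j)$ of the Ferrers diagram is the number of cells consisting of the cell itself, the cells to its right in its row and the cells below it in its column. A numerical set is a subset $S\subseteq\mathbb{N}_0$ containing $0$ with finite complement; a numerical semigroup is a numerical set closed under addition. For a partition $\lambda$ let $S_\lambda=\mathbb{N}_0\setminus\{h_{(i,1)}(\lambda):1\le i\le\ell(\lambda)\}$. $PM(n,m)$ is the number of partitions $\lambda$ of $n$ having exactly $m-1$ parts equal to $1$ such that $S_\lambda$ is a numerical semigroup. Here $\mathbb{N}$ is as written in the paper, which applies the case $j=0$. *)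

theory Defs
  imports Complex_Main
begin

definition is_partition :: "nat \<Rightarrow> nat list \<Rightarrow> bool" where
  "is_partition n lam \<longleftrightarrow> sorted_wrt (\<ge>) lam \<and> (\<forall>p\<in>set lam. p > 0) \<and> sum_list lam = n"

text \<open>Cells are 1-indexed as (row, column), whereas list positions are 0-indexed.\<close>

definition ferrers :: "nat list \<Rightarrow> (nat \<times> nat) set" where
  "ferrers lam = {(i, j). 1 \<le> i \<and> i \<le> length lam \<and> 1 \<le> j \<and> j \<le> lam ! (i - 1)}"

definition hook_length :: "nat list \<Rightarrow> nat \<times> nat \<Rightarrow> nat" where
  "hook_length lam = (\<lambda>(i, j). card {(a, b) \<in> ferrers lam. (a = i \<and> b \<ge> j) \<or> (b = j \<and> a \<ge> i)})"

definition numerical_set :: "nat set \<Rightarrow> bool" where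
  "numerical_set S \<longleftrightarrow> 0 \<in> S \<and> finite (UNIV - S)"

definition numerical_semigroup :: "nat set \<Rightarrow> bool" where
  "numerical_semigroup S \<longleftrightarrow> numerical_set S \<and> (\<forall>x\<in>S. \<forall>y\<in>S. x + y \<in> S)"

definition partition_numset :: "nat list \<Rightarrow> nat set" where
  "partition_numset lam = UNIV - {hook_length lam (i, 1) | i. 1 \<le> i \<and> i \<le> length lam}"

text \<open>``Exactly m - 1 parts equal to 1'' is written additively to avoid truncated
  subtraction at m = 0.\<close>

definition PM :: "nat \<Rightarrow> nat \<Rightarrow> nat" where
  "PM n m = card {lam. is_partition n lam \<and> count_list lam 1 + 1 = m \<and>
                       numerical_semigroup (partition_numset lam)}"

definition abar :: "nat \<Rightarrow> nat" where
  "abar N = card {lam. is_partition N lam \<and> length lam \<ge> 2 \<and> 1 \<notin> set lam \<and> lam ! 0 = lam ! 1}"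

lemma finite_partitions: "finite {lam. is_partition n lam}"
proof (rule finite_subset)
  have "length lam \<le> sum_list lam" if "\<forall>p\<in>set lam. p > 0" for lam :: "nat list"
    using that by (induction lam) auto
  then show "{lam. is_partition n lam} \<subseteq> {lam. set lam \<subseteq> {..n} \<and> length lam \<le> n}"
    using member_le_sum_list by (fastforce simp: is_partition_def)
  show "finite {lam. set lam \<subseteq> {..n} \<and> length lam \<le> n}"
    by (rule finite_lists_length_le) simp
qed

end

theory Submission
  imports Defs
begin

text \<open>
  Write a partition with \<open>m - 1\<close> ones as \<open>\<mu> @ 1\<dots>1\<close> with all parts of \<open>\<mu> = p # \<nu>\<close> at least 2,
  where \<open>|\<mu>| = m + 1 + j \<le> 2 m\<close>. The multiplicity of the numerical set is \<open>m\<close>, and all its gaps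
  but the largest lie below \<open>2 m\<close>. So only the largest gap can be a sum of two nonzero elements,
  and after translating by \<open>m\<close> this depends only on \<open>\<nu>\<close> and \<open>p - m\<close>. Hence \<open>(p, m) \<mapsto> (p + 1, m + 1)\<close>
  embeds the semigroup partitions for \<open>m\<close> into those for \<open>m + 1\<close>. The ones that are missed
  have \<open>\<mu>\<^sub>1 = \<mu>\<^sub>2\<close>; for these the largest gap is less than \<open>2 m + 2\<close>, so each of them is a
  semigroup partition.
\<close>

section \<open>First-column hook lengths\<close>

text \<open>Hooks extend only right and down, so removing the first row leaves the other hooks
  unchanged; hence the recursion.\<close>

primrec col_hooks :: "nat list \<Rightarrow> nat set" where
  "col_hooks [] = {}"
| "col_hooks (x # xs) = insert (x + length xs) (col_hooks xs)"

lemma col_hooks_conv_nth: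
  "col_hooks lam = (\<lambda>i. lam ! i + (length lam - Suc i)) ` {..<length lam}"
  by (induction lam) (auto simp: lessThan_Suc_eq_insert_0 image_image)

lemma hook_length_first_col:
  assumes "\<forall>p\<in>set lam. p > 0" "i < length lam"
  shows "hook_length lam (Suc i, 1) = lam ! i + (length lam - Suc i)"
proof -
  have pos: "lam ! k > 0" if "k < length lam" for k
    using assms(1) that by simp
  \<comment> \<open>The arm in the row plus the leg in column 1; positivity of the parts puts a cell
    of column 1 in every lower row.\<close>
  have "{(a, b) \<in> ferrers lam. (a = Suc i \<and> b \<ge> 1) \<or> (b = 1 \<and> a \<ge> Suc i)} =
      {Suc i} \<times> {1..lam ! i} \<union> {Suc (Suc i)..length lam} \<times> {1}" (is "?L = ?R")
  proof (rule set_eqI)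
    fix c :: "nat \<times> nat"
    obtain a b where c: "c = (a, b)" by fastforce
    show "c \<in> ?L \<longleftrightarrow> c \<in> ?R"
      using assms(2) pos[of "a - 1"] pos[of i] unfolding c ferrers_def
      by (cases "a = Suc i") (auto simp: Suc_le_eq)
  qed
  moreover have "card ?R = lam ! i + (length lam - Suc i)"
    by (subst card_Un_disjoint) (auto simp: card_cartesian_product)
  ultimately show ?thesis
    unfolding hook_length_def by simp
qed

lemma partition_numset_conv_col_hooks:
  assumes "\<forall>p\<in>set lam. p > 0"
  shows "partition_numset lam = - col_hooks lam"
proof -
  have "{hook_length lam (i, 1) | i. 1 \<le> i \<and> i \<le> length lam} =
      (\<lambda>i. hook_length lam (Suc i, 1)) ` {..<length lam}"
  proof (intro equalityI subsetI)
    fix x assume "x \<in> {hook_length lam (i, 1) | i. 1 \<le> i \<and> i \<le> length lam}"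
    then obtain i where "x = hook_length lam (i, 1)" "1 \<le> i" "i \<le> length lam" by blast
    then show "x \<in> (\<lambda>i. hook_length lam (Suc i, 1)) ` {..<length lam}"
      by (intro image_eqI[of _ _ "i - 1"]) auto
  qed (auto simp: Suc_le_eq)
  also have "\<dots> = col_hooks lam"
    unfolding col_hooks_conv_nth using hook_length_first_col[OF assms] by (intro image_cong) auto
  finally show ?thesis
    by (auto simp: partition_numset_def)
qed

lemma finite_col_hooks: "finite (col_hooks lam)"
  by (induction lam) auto

lemma col_hooks_append:
  "col_hooks (xs @ ys) = (+) (length ys) ` col_hooks xs \<union> col_hooks ys"
  by (induction xs) auto

lemma col_hooks_replicate_1: "col_hooks (replicate k 1) = {1..k}"
  by (induction k) auto

section \<open>Bounds on the gaps and the semigroup criterion\<close>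

lemma col_hooks_le:
  assumes "sorted_wrt (\<ge>) (x # xs)" "g \<in> col_hooks (x # xs)"
  shows "g \<le> x + length xs"
  using assms
proof (induction xs arbitrary: x)
  case (Cons y ys)
  then show ?case
    using Cons.IH[of y] by fastforce
qed simp

lemma two_mult_length_le_sum_list:
  assumes "\<forall>p\<in>set xs. 2 \<le> (p::nat)"
  shows "2 * length xs \<le> sum_list xs"
  using assms by (induction xs) auto

text \<open>For \<open>\<nu> = q # \<nu>'\<close> the largest hook is
  \<open>q + length \<nu>'\<close>; doubling it uses \<open>q \<le> p\<close> and that parts of
  \<open>\<nu>'\<close> are at least 2. If the total is at most \<open>2 * m\<close>, this gives
  \<open>g \<le> m\<close>.\<close>

lemma col_hooks_double_le:
  assumes "sorted_wrt (\<ge>) (p # \<nu>)" "\<forall>q\<in>set \<nu>. 2 \<le> q" "g \<in> col_hooks \<nu>"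
  shows "2 * g \<le> p + sum_list \<nu>"
proof (cases \<nu>)
  case (Cons q \<nu>')
  have "g \<le> q + length \<nu>'"
    using assms Cons by (intro col_hooks_le) auto
  moreover have "2 * length \<nu>' \<le> sum_list \<nu>'"
    using assms(2) Cons by (intro two_mult_length_le_sum_list) auto
  ultimately show ?thesis
    using assms(1) Cons by simp
qed (use assms in simp)

lemma col_hooks_append_ones:
  assumes "1 \<le> m"
  shows "g \<in> col_hooks (\<nu> @ replicate (m - 1) 1) \<longleftrightarrow>
    (1 \<le> g \<and> g < m) \<or> (m - 1 \<le> g \<and> g - (m - 1) \<in> col_hooks \<nu>)"
proof -
  have "g \<in> (+) (m - 1) ` col_hooks \<nu> \<longleftrightarrow> m - 1 \<le> g \<and> g - (m - 1) \<in> col_hooks \<nu>"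
    by (auto simp del: One_nat_def intro: image_eqI[of _ _ "g - (m - 1)"])
  then show ?thesis
    using assms unfolding col_hooks_append col_hooks_replicate_1 by auto
qed

text \<open>A pair \<open>x, y\<close> on the right-hand side stands for the elements \<open>m + x\<close> and \<open>m + y\<close> whose sum is
  the largest gap; the criterion is visibly invariant under \<open>(p, m) \<mapsto> (p + 1, m + 1)\<close>.\<close>

lemma numerical_semigroup_append_ones_iff:
  assumes sorted: "sorted_wrt (\<ge>) (p # \<nu>)" and ge2: "\<forall>q\<in>set (p # \<nu>). 2 \<le> q"
    and m: "1 \<le> m" and small: "p + sum_list \<nu> \<le> 2 * m"
  shows "numerical_semigroup (partition_numset ((p # \<nu>) @ replicate (m - 1) 1)) \<longleftrightarrow>
    \<not> (\<exists>x y. Suc x \<notin> col_hooks \<nu> \<and> Suc y \<notin> col_hooks \<nu> \<and> x + y + m + 1 = p + length \<nu>)"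
    (is "_ \<longleftrightarrow> \<not> ?B")
proof -
  define T where "T = col_hooks (\<nu> @ replicate (m - 1) 1)"
  \<comment> \<open>\<open>h\<close> is the hook of the first row, \<open>T\<close> the set of all
    other hooks.\<close>
  define h where "h = p + length \<nu> + (m - 1)"
  have num: "partition_numset ((p # \<nu>) @ replicate (m - 1) 1) = - insert h T"
    using ge2 by (subst partition_numset_conv_col_hooks) (force simp: T_def h_def)+
  have T_iff: "g \<in> T \<longleftrightarrow> (1 \<le> g \<and> g < m) \<or> (m - 1 \<le> g \<and> g - (m - 1) \<in> col_hooks \<nu>)" for g
    unfolding T_def using m by (rule col_hooks_append_ones)
  \<comment> \<open>The ones shift the hooks by \<open>m - 1\<close>, not by \<open>m\<close>, which
    accounts for the \<open>Suc\<close>.\<close>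
  have T_shift: "m + x \<in> T \<longleftrightarrow> Suc x \<in> col_hooks \<nu>" for x
    using m by (auto simp: T_iff Suc_diff_le)
  have le_m: "g \<le> m" if "g \<in> col_hooks \<nu>" for g
    using col_hooks_double_le[OF sorted _ that] ge2 small by simp
  have T_less: "g < 2 * m" if "g \<in> T" for g
    using that le_m[of "g - (m - 1)"] m by (auto simp: T_iff)
  have zero: "0 \<notin> col_hooks \<nu>"
    using ge2 by (induction \<nu>) auto
  have zero_T: "0 \<notin> T"
    using zero by (auto simp: T_iff)
  have h_pos: "h \<ge> m + 1"
    using ge2 m by (auto simp: h_def)
  show ?thesis
  proof
    assume sg: "numerical_semigroup (partition_numset ((p # \<nu>) @ replicate (m - 1) 1))"
    show "\<not> ?B"
    proof
      assume ?B
      then obtain x y where xy: "m + x \<notin> T" "m + y \<notin> T" "(m + x) + (m + y) = h"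
        using m by (auto simp: T_shift h_def)
      then have "m + x \<in> - insert h T" "m + y \<in> - insert h T"
        using m by auto
      then have "h \<in> - insert h T"
        using sg xy(3) unfolding num numerical_semigroup_def by metis
      then show False by simp
    qed
  next
    assume nB: "\<not> ?B"
    \<comment> \<open>Since \<open>1\<close>, ..., \<open>m - 1\<close> are gaps, nonzero
      \<open>a\<close> and \<open>b\<close> are at least \<open>m\<close>, and \<open>a + b\<close>
      lies above all of \<open>T\<close>; only \<open>a + b = h\<close> remains to be
      excluded.\<close>
    have "a + b \<notin> insert h T" if a: "a \<notin> insert h T" and b: "b \<notin> insert h T" for a b
    proof (cases "a = 0 \<or> b = 0")
      case False
      then have ge: "a \<ge> m" "b \<ge> m"
        using a b T_iff[of a] T_iff[of b] by auto
      then obtain x y where xy: "a = m + x" "b = m + y"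
        by (metis le_Suc_ex)
      have "a + b \<noteq> h"
      proof
        assume "a + b = h"
        then have "x + y + m + 1 = p + length \<nu>"
          using m by (simp add: xy h_def)
        then show False
          using nB a b T_shift unfolding xy by blast
      qed
      then show ?thesis
        using T_less[of "a + b"] ge by auto
    qed (use a b in auto)
    moreover have "finite (insert h T)"
      by (simp add: T_def finite_col_hooks)
    ultimately show "numerical_semigroup (partition_numset ((p # \<nu>) @ replicate (m - 1) 1))"
      unfolding num numerical_semigroup_def numerical_set_def
      using zero_T h_pos by (auto simp: Diff_eq)
  qed
qed

section \<open>Stripping the parts equal to 1\<close>

lemma sorted_filter_ones:
  assumes "sorted_wrt (\<ge>) lam" "\<forall>p\<in>set lam. p > (0::nat)"
  shows "filter (\<lambda>p. p \<noteq> 1) lam @ replicate (count_list lam 1) 1 = lam"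
  using assms
proof (induction lam)
  case (Cons x xs)
  show ?case
  proof (cases "x = 1")
    case True
    then have "\<forall>p\<in>set xs. p = 1"
      using Cons.prems by (auto simp: le_Suc_eq)
    then have "filter (\<lambda>p. p \<noteq> 1) xs = []" by simp
    then show ?thesis
      using Cons True by simp
  qed (use Cons in simp)
qed simp

definition core_partitions :: "nat \<Rightarrow> nat \<Rightarrow> nat list set" where
  "core_partitions N m = {\<mu>. is_partition N \<mu> \<and> 1 \<notin> set \<mu> \<and>
     numerical_semigroup (partition_numset (\<mu> @ replicate (m - 1) 1))}"

lemma finite_core_partitions: "finite (core_partitions N m)"
  by (rule finite_subset[OF _ finite_partitions[of N]]) (auto simp: core_partitions_def)

text \<open>The ones form the tail of a weakly decreasing list, so appending them is a bijection. At
  \<open>m = 0\<close>, \<open>PM\<close> is 0 while \<open>m - 1\<close> truncates to 0.\<close>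

lemma PM_conv_core_partitions:
  assumes "1 \<le> m"
  shows "PM (N + (m - 1)) m = card (core_partitions N m)"
proof -
  let ?f = "\<lambda>\<mu>. \<mu> @ replicate (m - 1) (1::nat)"
  have "{lam. is_partition (N + (m - 1)) lam \<and> count_list lam 1 + 1 = m \<and>
          numerical_semigroup (partition_numset lam)} = ?f ` core_partitions N m" (is "?L = ?R")
  proof (intro equalityI subsetI)
    fix lam assume lam: "lam \<in> ?L"
    let ?\<mu> = "filter (\<lambda>p. p \<noteq> 1) lam"
    have eq: "?f ?\<mu> = lam"
      using lam sorted_filter_ones[of lam] by (auto simp: is_partition_def)
    then have "sum_list (?f ?\<mu>) = N + (m - 1)"
      using lam by (simp only: is_partition_def mem_Collect_eq)
    then have "is_partition N ?\<mu>"
      using lam by (auto simp: is_partition_def sorted_wrt_filter sum_list_replicate)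
    then have "?\<mu> \<in> core_partitions N m"
      using lam eq unfolding core_partitions_def by simp
    then show "lam \<in> ?R"
      using eq by (metis image_eqI)
  next
    fix lam assume "lam \<in> ?R"
    moreover have "sorted_wrt (\<ge>) (replicate k (1::nat))" "count_list (replicate k (1::nat)) 1 = k" for k
      by (induction k) auto
    ultimately show "lam \<in> ?L"
      using assms
      by (auto simp: core_partitions_def is_partition_def sorted_wrt_append sum_list_replicate
          Suc_le_eq count_list_0_iff)
  qed
  moreover have "inj_on ?f (core_partitions N m)"
    by (auto simp: inj_on_def)
  ultimately show ?thesis
    unfolding PM_def by (simp add: card_image)
qed

lemma core_partitions_iff:
  assumes "1 \<le> m" "N \<le> 2 * m"
  shows "p # \<nu> \<in> core_partitions N m \<longleftrightarrow>
    sorted_wrt (\<ge>) (p # \<nu>) \<and> (\<forall>q\<in>set (p # \<nu>). 2 \<le> q) \<and> p + sum_list \<nu> = N \<and>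
    \<not> (\<exists>x y. Suc x \<notin> col_hooks \<nu> \<and> Suc y \<notin> col_hooks \<nu> \<and> x + y + m + 1 = p + length \<nu>)"
proof -
  have "is_partition N (p # \<nu>) \<and> 1 \<notin> set (p # \<nu>) \<longleftrightarrow>
      sorted_wrt (\<ge>) (p # \<nu>) \<and> (\<forall>q\<in>set (p # \<nu>). 2 \<le> q) \<and> p + sum_list \<nu> = N"
  proof -
    have "0 < q \<and> q \<noteq> 1 \<longleftrightarrow> 2 \<le> q" for q :: nat by auto
    then show ?thesis
      unfolding is_partition_def by (metis sum_list.Cons)
  qed
  then show ?thesis
    using numerical_semigroup_append_ones_iff[of p \<nu> m] assms
    unfolding core_partitions_def by auto
qed

section \<open>Raising the first part\<close>

definition flat_partitions :: "nat \<Rightarrow> nat list set" where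
  "flat_partitions N =
     {lam. is_partition N lam \<and> length lam \<ge> 2 \<and> 1 \<notin> set lam \<and> lam ! 0 = lam ! 1}"

text \<open>The embedding from \<open>m\<close> to \<open>m + 1\<close>; its value at
  \<open>[]\<close> keeps it injective on all lists.\<close>

fun inc_hd :: "nat list \<Rightarrow> nat list" where
  "inc_hd [] = []"
| "inc_hd (p # \<nu>) = Suc p # \<nu>"

lemma inj_inc_hd: "inj inc_hd"
proof (rule injI)
  fix xs ys assume "inc_hd xs = inc_hd ys"
  then show "xs = ys" by (cases xs; cases ys) auto
qed

lemma flat_partitions_subset:
  assumes "N \<le> 2 * m + 1"
  shows "flat_partitions N \<subseteq> core_partitions N (Suc m)"
proof
  fix lam assume lam: "lam \<in> flat_partitions N"
  then obtain p \<nu>' where eq: "lam = p # p # \<nu>'"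
    by (auto simp: flat_partitions_def numeral_2_eq_2 Suc_le_length_iff)
  have part: "sorted_wrt (\<ge>) lam" "\<forall>q\<in>set lam. 2 \<le> q" "sum_list lam = N"
    using lam by (auto simp: flat_partitions_def is_partition_def)
      (metis One_nat_def Suc_leI le_neq_implies_less numeral_2_eq_2)
  have "2 * length \<nu>' \<le> sum_list \<nu>'"
    using part(2) eq by (intro two_mult_length_le_sum_list) auto
  \<comment> \<open>Twice the left side is at most \<open>N \<le> 2 * m + 1\<close>. The equation
    forbidden by the criterion becomes \<open>x + y + m + 1 = p + length \<nu>'\<close>, so it has
    no solution.\<close>
  then have "p + length \<nu>' \<le> m"
    using part(3) eq assms by simp
  then show "lam \<in> core_partitions N (Suc m)"
    using part assms unfolding eq by (subst core_partitions_iff) auto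
qed

text \<open>Raising \<open>p\<close> and \<open>m\<close> together preserves the criterion;
  conversely, the first part can be lowered unless it equals the second.\<close>

lemma core_partitions_Suc:
  assumes m: "1 \<le> m" and N: "m < N" "N \<le> 2 * m"
  shows "core_partitions (Suc N) (Suc m) =
    inc_hd ` core_partitions N m \<union> flat_partitions (Suc N)"
proof (intro equalityI subsetI)
  fix lam assume lam: "lam \<in> core_partitions (Suc N) (Suc m)"
  then obtain p \<nu> where eq: "lam = p # \<nu>"
    by (cases lam) (auto simp: core_partitions_def is_partition_def)
  have core: "sorted_wrt (\<ge>) (p # \<nu>)" "\<forall>q\<in>set (p # \<nu>). 2 \<le> q" "p + sum_list \<nu> = Suc N"
    "\<not> (\<exists>x y. Suc x \<notin> col_hooks \<nu> \<and> Suc y \<notin> col_hooks \<nu> \<and> x + y + Suc m + 1 = p + length \<nu>)"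
    using lam core_partitions_iff[of "Suc m" "Suc N" p \<nu>] N unfolding eq by auto
  show "lam \<in> inc_hd ` core_partitions N m \<union> flat_partitions (Suc N)"
  proof (cases "\<nu> \<noteq> [] \<and> hd \<nu> = p")
    case True
    then obtain \<nu>' where "\<nu> = p # \<nu>'" by (cases \<nu>) auto
    then show ?thesis
      using lam eq by (auto simp: flat_partitions_def core_partitions_def)
  next
    case False
    have "\<forall>q\<in>set \<nu>. q < p"
      using core(1) False by (cases \<nu>) force+
    \<comment> \<open>The lowered first part must stay at least 2. A single part is
      \<open>Suc N\<close> with \<open>N > m\<close>; otherwise \<open>p\<close> exceeds a part that
      is at least 2.\<close>
    moreover have "p \<ge> 3"
    proof (cases \<nu>)
      case Nil
      then show ?thesis using core(3) m N by simp
    next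
      case (Cons q \<nu>')
      then show ?thesis using core(2) \<open>\<forall>q\<in>set \<nu>. q < p\<close> by force
    qed
    ultimately have "(p - 1) # \<nu> \<in> core_partitions N m"
      using core m N by (subst core_partitions_iff) force+
    moreover have "lam = inc_hd ((p - 1) # \<nu>)"
      using \<open>p \<ge> 3\<close> eq by simp
    ultimately show ?thesis by blast
  qed
next
  fix lam assume "lam \<in> inc_hd ` core_partitions N m \<union> flat_partitions (Suc N)"
  then show "lam \<in> core_partitions (Suc N) (Suc m)"
  proof
    assume "lam \<in> inc_hd ` core_partitions N m"
    then obtain \<mu> where \<mu>: "\<mu> \<in> core_partitions N m" "lam = inc_hd \<mu>" by blast
    then obtain p \<nu> where "\<mu> = p # \<nu>"
      using N by (cases \<mu>) (auto simp: core_partitions_def is_partition_def)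
    then show ?thesis
      using \<mu> m N core_partitions_iff[of m N p \<nu>] core_partitions_iff[of "Suc m" "Suc N" "Suc p" \<nu>]
      by auto
  next
    assume "lam \<in> flat_partitions (Suc N)"
    then show ?thesis
      using flat_partitions_subset[of "Suc N" m] N by auto
  qed
qed

text \<open>Raising the first part of a sorted list makes it strictly larger than the
  second.\<close>

lemma inc_hd_core_flat_disjoint:
  "inc_hd ` core_partitions N m \<inter> flat_partitions N' = {}"
proof -
  have "inc_hd \<mu> \<notin> flat_partitions N'" if "is_partition N \<mu>" for \<mu>
    \<comment> \<open>The rule serves only to split into lists of length 0, 1 and at least
      2.\<close>
    using that by (cases \<mu> rule: remdups_adj.cases) (auto simp: flat_partitions_def is_partition_def)
  then show ?thesis
    by (auto simp: core_partitions_def)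
qed

lemma PM_Suc:
  assumes "Suc j \<le> m"
  shows "PM (2 * Suc m + j) (Suc m) = PM (2 * m + j) m + abar (m + j + 2)"
proof -
  \<comment> \<open>What remains of \<open>2 * m + j\<close> without \<open>m - 1\<close> ones;
    \<open>Suc j \<le> m\<close> says exactly that \<open>?N \<le> 2 * m\<close>.\<close>
  let ?N = "m + 1 + j"
  have fin: "finite (flat_partitions (Suc ?N))"
    by (rule finite_subset[OF _ finite_partitions[of "Suc ?N"]]) (auto simp: flat_partitions_def)
  have "PM (2 * Suc m + j) (Suc m) = card (core_partitions (Suc ?N) (Suc m))"
    using PM_conv_core_partitions[of "Suc m" "Suc ?N"] by (simp add: mult_2 add_ac)
  also have "\<dots> = card (inc_hd ` core_partitions ?N m \<union> flat_partitions (Suc ?N))"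
    using core_partitions_Suc[of m ?N] assms by simp
  also have "\<dots> = card (core_partitions ?N m) + card (flat_partitions (Suc ?N))"
    using fin finite_core_partitions inc_hd_core_flat_disjoint inj_inc_hd
    by (subst card_Un_disjoint) (auto simp: card_image inj_on_subset)
  also have "card (core_partitions ?N m) = PM (2 * m + j) m"
  proof -
    have "?N + (m - 1) = 2 * m + j" using assms by simp
    then show ?thesis
      using PM_conv_core_partitions[of m ?N] assms by (metis Suc_le_D le_add1 plus_1_eq_Suc)
  qed
  also have "card (flat_partitions (Suc ?N)) = abar (m + j + 2)"
    by (simp add: flat_partitions_def abar_def)
  finally show ?thesis .
qed

theorem theorem5p5:
  fixes j n :: nat
  assumes "n \<ge> 2 * j + 2"
  shows "int (PM (2 * n - j) (n - j)) - int (PM (2 * (n - 1) - j) ((n - 1) - j)) = int (abar (n + 1))"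
proof -
  \<comment> \<open>Then \<open>n = m + 1 + j\<close>, no subtraction truncates, and the hypothesis
    on \<open>n\<close> becomes \<open>Suc j \<le> m\<close>.\<close>
  define m where "m = n - 1 - j"
  have "2 * n - j = 2 * Suc m + j" "n - j = Suc m" "2 * (n - 1) - j = 2 * m + j"
    "n + 1 = m + j + 2" "Suc j \<le> m"
    using assms by (auto simp: m_def)
  then show ?thesis
    using PM_Suc[of j m] by (simp add: m_def)
qed

end
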